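(* Assume that there exist at least two indices $j\in\{1,\dots,n\}$ with $\bar z^k_j\neq 0$ whose corresponding eigenvalues $\lambda_j$ are distinct. Set $$a=\sum_{j=1}^n\lambda_j\bar z^k_j,\quad b=\sum_{j=1}^n\lambda_j^2\bar z^k_j,\quad c=\sum_{j=1}^n\lambda_j^3\bar z^k_j,\quad d=\sum_{j=1}^n\lambda_j^4\bar z^k_j.$$ Then the two-step optimal step sizes, i.e. the global minimizers $(\theta^k,\theta^{k+1})\in\mathbf{R}^2$ of $$\sum_{i=1}^N\left\|(I-\theta^{k+1}P)(I-\theta^kP)\left(z^k_\theta(x_i)-z^\star(x_i)\right)\right\|_2^2,$$ are non-negative and are given by the two values $$\frac{ad-bc\pm\sqrt{(bc-ad)^2-4(ac-b^2)(bd-c^2)}}{2(bd-c^2)},$$ in either order (one of $\theta^k,\theta^{k+1}$ is the value with $+$ and the other the value with $-$).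
   Context: Let $P\in\mathbf{R}^{n\times n}$ be symmetric positive definite with eigendecomposition $P=Q\,\mathrm{diag}(\lambda)Q^T$, $Q$ orthogonal, $\lambda_1,\dots,\lambda_n>0$. For a parameter $x\in\mathbf{R}^n$ consider the problem of minimizing $(1/2)z^TPz+x^Tz$ over $z\in\mathbf{R}^n$, with solution $z^\star(x)=-P^{-1}x$. Given parameters $x_1,\dots,x_N\in\mathbf{R}^n$, an integer $k\ge0$, and previously fixed step sizes $\theta^0,\dots,\theta^{k-1}\in\mathbf{R}$, the points $z^k_\theta(x_i)$ are the gradient descent iterates $z^{l+1}_\theta(x)=z^l_\theta(x)-\theta^l(Pz^l_\theta(x)+x)$, $z^0_\theta(x)=0$; they are fixed data in the two-step problem. Define $$\bar z^k_j=\sum_{i=1}^N\left(Q^T(z^k_\theta(x_i)-z^\star(x_i))\right)_j^2\ge 0,\qquad j=1,\dots,n.$$ *)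

theory Defs
  imports "HOL-Analysis.Analysis"
begin

definition symmetric_posdef :: "real^'n^'n \<Rightarrow> bool" where
  "symmetric_posdef P \<longleftrightarrow> transpose P = P \<and> (\<forall>v. v \<noteq> 0 \<longrightarrow> v \<bullet> (P *v v) > 0)"

definition diag :: "real^'n \<Rightarrow> real^'n^'n" where
  "diag lam = (\<chi> i j. if i = j then lam $ i else 0)"

definition quad_obj :: "real^'n^'n \<Rightarrow> real^'n \<Rightarrow> real^'n \<Rightarrow> real" where
  "quad_obj P x z = (1/2) * (z \<bullet> (P *v z)) + x \<bullet> z"

definition zstar :: "real^'n^'n \<Rightarrow> real^'n \<Rightarrow> real^'n" where
  "zstar P x = - (matrix_inv P *v x)"

primrec gd_iter :: "real^'n^'n \<Rightarrow> (nat \<Rightarrow> real) \<Rightarrow> real^'n \<Rightarrow> nat \<Rightarrow> real^'n" where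
  "gd_iter P \<theta> x 0 = 0"
| "gd_iter P \<theta> x (Suc l) =
     gd_iter P \<theta> x l - \<theta> l *\<^sub>R (P *v gd_iter P \<theta> x l + x)"

definition zbar ::
  "real^'n^'n \<Rightarrow> real^'n^'n \<Rightarrow> (nat \<Rightarrow> real) \<Rightarrow> nat \<Rightarrow> (nat \<Rightarrow> real^'n) \<Rightarrow> nat \<Rightarrow> 'n \<Rightarrow> real" where
  "zbar Q P \<theta> N x k j =
     (\<Sum>i=1..N. ((transpose Q *v (gd_iter P \<theta> (x i) k - zstar P (x i))) $ j)\<^sup>2)"

text \<open>The pair argument is \<open>(\<theta>\<^sup>k, \<theta>\<^sup>k\<^sup>+\<^sup>1)\<close>; the iterate \<open>gd_iter P \<theta> (x i) k\<close> only depends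
  on the values of \<open>\<theta>\<close> at indices below \<open>k\<close>.\<close>

definition two_step_obj ::
  "real^'n^'n \<Rightarrow> (nat \<Rightarrow> real) \<Rightarrow> nat \<Rightarrow> (nat \<Rightarrow> real^'n) \<Rightarrow> nat \<Rightarrow> real \<times> real \<Rightarrow> real" where
  "two_step_obj P \<theta> N x k = (\<lambda>(s, t).
     \<Sum>i=1..N. (norm (((mat 1 - t *\<^sub>R P) ** (mat 1 - s *\<^sub>R P)) *v
                       (gd_iter P \<theta> (x i) k - zstar P (x i))))\<^sup>2)"

lemma zstar_stationary:
  fixes P :: "real^'n^'n"
  assumes "symmetric_posdef P"
  shows "P *v zstar P x = - x"
proof -
  have "v = 0" if "P *v v = 0" for v
    using assms that unfolding symmetric_posdef_def by (metis inner_zero_right less_irrefl)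
  then have "\<exists>B. B ** P = mat 1"
    by (simp add: matrix_left_invertible_ker)
  then have "\<exists>B. P ** B = mat 1 \<and> B ** P = mat 1"
    using matrix_left_right_inverse by blast
  then have "P ** matrix_inv P = mat 1"
    unfolding matrix_inv_def by (rule someI2_ex) blast
  then have "P *v (matrix_inv P *v x) = x"
    by (simp add: matrix_vector_mul_assoc)
  moreover have "P *v (- u) = - (P *v u)" for u
    using matrix_vector_mult_diff_distrib[of P 0 u] by simp
  ultimately show ?thesis
    by (simp add: zstar_def)
qed

lemma zstar_minimizer:
  fixes P :: "real^'n^'n"
  assumes P: "symmetric_posdef P"
  shows "is_arg_min (quad_obj P x) (\<lambda>_. True) z \<longleftrightarrow> z = zstar P x"
proof -
  define w where "w = zstar P x"
  have x: "x = - (P *v w)" using zstar_stationary[OF P, of x] by (simp add: w_def)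
  have "w \<bullet> (P *v u) = u \<bullet> (P *v w)" for u
  proof -
    have "w \<bullet> (P *v u) = (transpose P *v w) \<bullet> u"
      by (simp add: dot_lmul_matrix[symmetric])
    also have "\<dots> = u \<bullet> (P *v w)"
      using P by (simp add: symmetric_posdef_def inner_commute)
    finally show ?thesis .
  qed
  note sym = this
  have gap: "quad_obj P x y = quad_obj P x w + (1/2) * ((y - w) \<bullet> (P *v (y - w)))" for y
  proof -
    have "x \<bullet> y = - (y \<bullet> (P *v w))" "x \<bullet> w = - (w \<bullet> (P *v w))"
      unfolding x by (simp_all add: inner_commute)
    then show ?thesis
      using sym[of y] unfolding quad_obj_def
      by (simp add: matrix_vector_mult_diff_distrib inner_diff_left inner_diff_right field_simps)
  qed
  have lt: "quad_obj P x w < quad_obj P x y" if "y \<noteq> w" for y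
  proof -
    have "(y - w) \<bullet> (P *v (y - w)) > 0"
      using P that unfolding symmetric_posdef_def by auto
    then show ?thesis using gap[of y] by linarith
  qed
  show ?thesis
  proof
    assume "is_arg_min (quad_obj P x) (\<lambda>_. True) z"
    then have "\<not> quad_obj P x w < quad_obj P x z" by (simp add: is_arg_min_def)
    then show "z = zstar P x" using lt[of z] by (auto simp: w_def)
  next
    assume "z = zstar P x"
    then have "z = w" by (simp add: w_def)
    moreover have "\<not> quad_obj P x y < quad_obj P x w" for y
      using lt[of y] by (cases "y = w") auto
    ultimately show "is_arg_min (quad_obj P x) (\<lambda>_. True) z"
      by (simp add: is_arg_min_def)
  qed
qed

end

theory Submission
  imports Defs
begin

text \<open>In the eigenbasis the objective is \<open>\<Sum>j. w j * (1 - p * \<mu> j + q * (\<mu> j)\<^sup>2)\<^sup>2\<close> with \<open>w = zbar\<close>,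
  \<open>p = s + t\<close> and \<open>q = s * t\<close>. This is a strictly convex quadratic in \<open>(p, q)\<close>, and at its
  minimizer the polynomial \<open>f(\<mu>) = 1 - p * \<mu> + q * \<mu>\<^sup>2\<close> satisfies \<open>\<Sum>j. w j * \<mu> j * f(\<mu> j) = 0\<close>.
  Since \<open>q > 0\<close>, a negative discriminant or \<open>p \<le> 0\<close> would make \<open>f\<close> positive on the positive
  half-line, which contradicts that relation. Hence \<open>(p, q)\<close> comes from real step sizes, namely
  from the two roots of \<open>X\<^sup>2 - p * X + q\<close>.\<close>

text \<open>The right side minus the left is the total weight times the sum of squared deviations of
  \<open>f\<close> from its weighted mean \<open>t\<close>. Equality is excluded because
  \<open>f i1\<close> and \<open>f i2\<close> cannot both equal \<open>t\<close>.\<close>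

lemma Cauchy_Schwarz_weighted_strict:
  fixes w f :: "'a \<Rightarrow> real"
  assumes "finite A" and nonneg: "\<And>j. j \<in> A \<Longrightarrow> w j \<ge> 0"
    and i: "i1 \<in> A" "i2 \<in> A" "w i1 \<noteq> 0" "w i2 \<noteq> 0" "f i1 \<noteq> f i2"
  shows "(\<Sum>j\<in>A. w j * f j)\<^sup>2 < (\<Sum>j\<in>A. w j) * (\<Sum>j\<in>A. w j * (f j)\<^sup>2)"
proof -
  define S0 S1 S2 where S: "S0 = (\<Sum>j\<in>A. w j)" "S1 = (\<Sum>j\<in>A. w j * f j)"
    "S2 = (\<Sum>j\<in>A. w j * (f j)\<^sup>2)"
  define t where "t = S1 / S0"
  have "w i1 > 0" "w i2 > 0"
    using i nonneg by (simp_all add: order.strict_iff_order)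
  then have "S0 > 0"
    unfolding S using i nonneg \<open>finite A\<close> by (intro sum_pos2[of A i1]) auto
  obtain i where i': "i \<in> A" "w i > 0" "f i \<noteq> t"
    using i \<open>w i1 > 0\<close> \<open>w i2 > 0\<close> by metis
  have "0 < (\<Sum>j\<in>A. w j * (f j - t)\<^sup>2)"
    using i' nonneg \<open>finite A\<close> by (intro sum_pos2[of A i]) auto
  also have "\<dots> = (\<Sum>j\<in>A. w j * (f j)\<^sup>2 - 2 * t * (w j * f j) + t\<^sup>2 * w j)"
    by (intro sum.cong) (auto simp: power2_eq_square algebra_simps)
  also have "\<dots> = S2 - 2 * t * S1 + t\<^sup>2 * S0"
    by (simp add: S sum.distrib sum_subtractf sum_distrib_left)
  also have "\<dots> = (S0 * S2 - S1\<^sup>2) / S0"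
    using \<open>S0 > 0\<close> by (simp add: t_def field_simps power2_eq_square)
  finally show ?thesis
    using \<open>S0 > 0\<close> by (simp add: S zero_less_divide_iff)
qed

text \<open>Multiplying the form by \<open>b\<close> and completing the square in \<open>u\<close>
  leaves the remainder \<open>(b * d - c\<^sup>2) * v\<^sup>2\<close>. The form will be the
  second-order part of the objective.\<close>

lemma posdef_binary_quadratic_form:
  fixes b c d u v :: real
  assumes "b > 0" "c\<^sup>2 < b * d"
  shows "b * u\<^sup>2 - 2 * c * u * v + d * v\<^sup>2 \<ge> 0"
    and "b * u\<^sup>2 - 2 * c * u * v + d * v\<^sup>2 = 0 \<longleftrightarrow> u = 0 \<and> v = 0"
proof -
  define g where "g = b * u\<^sup>2 - 2 * c * u * v + d * v\<^sup>2"
  have sq: "b * g = (b * u - c * v)\<^sup>2 + (b * d - c\<^sup>2) * v\<^sup>2"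
    unfolding g_def by (simp add: power2_eq_square algebra_simps)
  have "b * g \<ge> 0"
    unfolding sq using assms by (intro add_nonneg_nonneg mult_nonneg_nonneg) auto
  then show "b * u\<^sup>2 - 2 * c * u * v + d * v\<^sup>2 \<ge> 0"
    using assms by (simp add: g_def zero_le_mult_iff)
  have "u = 0 \<and> v = 0" if "g = 0"
  proof -
    have nn: "(b * d - c\<^sup>2) * v\<^sup>2 \<ge> 0" "(b * u - c * v)\<^sup>2 \<ge> 0"
      using assms by auto
    with sq that have "(b * d - c\<^sup>2) * v\<^sup>2 = 0" "(b * u - c * v)\<^sup>2 = 0"
      by (simp_all add: add_nonneg_eq_0_iff)
    then show ?thesis
      using assms by auto
  qed
  then show "b * u\<^sup>2 - 2 * c * u * v + d * v\<^sup>2 = 0 \<longleftrightarrow> u = 0 \<and> v = 0"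
    by (auto simp: g_def)
qed

text \<open>Vieta: eliminating \<open>t\<close> shows that \<open>s\<close> is a root of the monic
  quadratic with roots \<open>r\<close> and \<open>r'\<close>. This turns uniqueness of the sum and
  product into uniqueness of the step sizes up to order.\<close>

lemma sum_prod_eq_iff:
  fixes s t r r' :: "'a::idom"
  shows "s + t = r + r' \<and> s * t = r * r' \<longleftrightarrow> (s = r \<and> t = r') \<or> (s = r' \<and> t = r)"
proof
  assume *: "s + t = r + r' \<and> s * t = r * r'"
  then have t: "t = r + r' - s"
    by (simp add: algebra_simps)
  with * have "(s - r) * (s - r') = 0"
    by (simp add: algebra_simps)
  then show "(s = r \<and> t = r') \<or> (s = r' \<and> t = r)"
    using t by auto
qed auto

text \<open>If the discriminant is negative, complete the square starting from the constant term 1;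
  if \<open>p \<le> 0\<close>, no term is negative.\<close>

lemma positive_quadratic:
  fixes p q y :: real
  assumes "q > 0" "y > 0" "p\<^sup>2 < 4 * q \<or> p \<le> 0"
  shows "1 - p * y + q * y\<^sup>2 > 0"
  using assms(3)
proof
  assume "p\<^sup>2 < 4 * q"
  then have "0 < (1 - p * y / 2)\<^sup>2 + (4 * q - p\<^sup>2) / 4 * y\<^sup>2"
    using assms by (intro add_nonneg_pos mult_pos_pos) auto
  also have "\<dots> = 1 - p * y + q * y\<^sup>2"
    by (simp add: power2_eq_square field_simps)
  finally show ?thesis .
next
  assume "p \<le> 0"
  then have "p * y \<le> 0" "q * y\<^sup>2 > 0"
    using assms by (auto simp: mult_nonpos_nonneg)
  then show ?thesis
    by linarith
qed

text \<open>Sum and product of the step sizes are treated as independent variables \<open>x\<close>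
  and \<open>y\<close>, although real step sizes only reach the region
  \<open>4 * y \<le> x\<^sup>2\<close>. The conclusion \<open>4 * q \<le> p\<^sup>2\<close> places
  the unconstrained minimizer in that region.\<close>

lemma weighted_quadratic_minimizer:
  fixes w \<mu> :: "'a \<Rightarrow> real"
  assumes "finite A" and w: "\<And>j. j \<in> A \<Longrightarrow> w j \<ge> 0" and \<mu>: "\<And>j. j \<in> A \<Longrightarrow> \<mu> j > 0"
    and i: "i1 \<in> A" "i2 \<in> A" "w i1 \<noteq> 0" "w i2 \<noteq> 0" "\<mu> i1 \<noteq> \<mu> i2"
    and abcd: "a = (\<Sum>j\<in>A. \<mu> j * w j)" "b = (\<Sum>j\<in>A. (\<mu> j)^2 * w j)"
      "c = (\<Sum>j\<in>A. (\<mu> j)^3 * w j)" "d = (\<Sum>j\<in>A. (\<mu> j)^4 * w j)"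
    and p: "p = (a * d - b * c) / (b * d - c\<^sup>2)" and q: "q = (a * c - b\<^sup>2) / (b * d - c\<^sup>2)"
    and G: "G = (\<lambda>x y. \<Sum>j\<in>A. w j * (1 - x * \<mu> j + y * (\<mu> j)\<^sup>2)\<^sup>2)"
  shows "c\<^sup>2 < b * d" and "q > 0" and "p > 0" and "4 * q \<le> p\<^sup>2"
    and "G p q \<le> G x y" and "G x y = G p q \<longleftrightarrow> x = p \<and> y = q"
proof -
  \<comment> \<open>Consecutive moments: weights \<open>\<mu> j * w j\<close> compare
    \<open>a\<close>, \<open>b\<close>, \<open>c\<close>, and below, weights
    \<open>(\<mu> j)\<^sup>2 * w j\<close> compare \<open>b\<close>, \<open>c\<close>,
    \<open>d\<close>.\<close>
  have "(\<Sum>j\<in>A. (\<mu> j * w j) * \<mu> j)\<^sup>2 < (\<Sum>j\<in>A. \<mu> j * w j) * (\<Sum>j\<in>A. (\<mu> j * w j) * (\<mu> j)\<^sup>2)"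
    by (rule Cauchy_Schwarz_weighted_strict[of A _ i1 i2])
      (use assms(1) w \<mu> i in \<open>auto simp: less_imp_le\<close>, (metis less_irrefl)+)
  also have "(\<Sum>j\<in>A. (\<mu> j * w j) * \<mu> j) = b"
    unfolding abcd by (intro sum.cong) (auto simp: power2_eq_square)
  also have "(\<Sum>j\<in>A. (\<mu> j * w j) * (\<mu> j)\<^sup>2) = c"
    unfolding abcd by (intro sum.cong) (auto simp: power2_eq_square power3_eq_cube)
  finally have ac: "b\<^sup>2 < a * c"
    by (simp add: abcd)
  have "(\<Sum>j\<in>A. ((\<mu> j)\<^sup>2 * w j) * \<mu> j)\<^sup>2
      < (\<Sum>j\<in>A. (\<mu> j)\<^sup>2 * w j) * (\<Sum>j\<in>A. ((\<mu> j)\<^sup>2 * w j) * (\<mu> j)\<^sup>2)"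
    by (rule Cauchy_Schwarz_weighted_strict[of A _ i1 i2])
      (use assms(1) w \<mu> i in \<open>auto simp: less_imp_le\<close>, (metis less_irrefl)+)
  also have "(\<Sum>j\<in>A. ((\<mu> j)\<^sup>2 * w j) * \<mu> j) = c"
    unfolding abcd by (intro sum.cong) (auto simp: power2_eq_square power3_eq_cube)
  also have "(\<Sum>j\<in>A. ((\<mu> j)\<^sup>2 * w j) * (\<mu> j)\<^sup>2) = d"
    unfolding abcd by (intro sum.cong) (auto simp: power2_eq_square power4_eq_xxxx)
  finally show bd: "c\<^sup>2 < b * d"
    by (simp add: abcd)
  show "q > 0"
    using ac bd by (simp add: q)
  have "w i1 > 0" "\<mu> i1 > 0"
    using i w \<mu> by (simp_all add: order.strict_iff_order)
  then have "b > 0"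
    unfolding abcd using i w \<open>finite A\<close> by (intro sum_pos2[of A i1] mult_pos_pos) auto
  have "b * d - c\<^sup>2 \<noteq> 0"
    using bd by simp
  \<comment> \<open>These say that both partial derivatives of \<open>G\<close> vanish at
    \<open>(p, q)\<close>; the defining quotients of \<open>p\<close> and \<open>q\<close> are
    Cramer's rule for this linear system.\<close>
  have normal_eqs: "a = b * p - c * q" "b = c * p - d * q"
    using \<open>b * d - c\<^sup>2 \<noteq> 0\<close> unfolding p q
    by (simp_all add: divide_simps) (simp_all add: power2_eq_square algebra_simps)

  have "\<not> (p\<^sup>2 < 4 * q \<or> p \<le> 0)"
  proof
    assume "p\<^sup>2 < 4 * q \<or> p \<le> 0"
    then have pos: "1 - p * \<mu> j + q * (\<mu> j)\<^sup>2 > 0" if "j \<in> A" for j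
      using positive_quadratic[of q "\<mu> j" p] \<open>q > 0\<close> \<mu>[OF that] by simp
    \<comment> \<open>Up to the factor -2 this sum is the partial derivative of \<open>G\<close> in
      its first argument at \<open>(p, q)\<close>, so the first normal equation makes it
      zero.\<close>
    have "0 < (\<Sum>j\<in>A. \<mu> j * w j * (1 - p * \<mu> j + q * (\<mu> j)\<^sup>2))"
      using i w \<mu> pos \<open>w i1 > 0\<close> \<open>finite A\<close>
      by (intro sum_pos2[of A i1] mult_pos_pos mult_nonneg_nonneg) (auto simp: less_imp_le)
    also have "\<dots> = (\<Sum>j\<in>A. \<mu> j * w j - p * ((\<mu> j)^2 * w j) + q * ((\<mu> j)^3 * w j))"
      by (intro sum.cong) (auto simp: power2_eq_square power3_eq_cube algebra_simps)
    also have "\<dots> = a - p * b + q * c"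
      by (simp add: abcd sum.distrib sum_subtractf sum_distrib_left)
    also have "\<dots> = 0"
      using normal_eqs(1) by (simp add: mult.commute)
    finally show False
      by simp
  qed
  then show "p > 0" "4 * q \<le> p\<^sup>2"
    by auto

  have G_eq: "G x y = (\<Sum>j\<in>A. w j) - 2 * a * x + 2 * b * y + b * x\<^sup>2 - 2 * c * x * y + d * y\<^sup>2" for x y
  proof -
    have "G x y = (\<Sum>j\<in>A. w j - 2 * x * (\<mu> j * w j) + 2 * y * ((\<mu> j)^2 * w j)
        + x\<^sup>2 * ((\<mu> j)^2 * w j) - 2 * x * y * ((\<mu> j)^3 * w j) + y\<^sup>2 * ((\<mu> j)^4 * w j))"
      unfolding G by (intro sum.cong)
        (auto simp: power2_eq_square power3_eq_cube power4_eq_xxxx algebra_simps)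
    also have "\<dots> = (\<Sum>j\<in>A. w j) - 2 * x * a + 2 * y * b + x\<^sup>2 * b - 2 * x * y * c + y\<^sup>2 * d"
      unfolding abcd sum_distrib_left sum.distrib sum_subtractf ..
    finally show ?thesis
      by (simp add: algebra_simps)
  qed
  \<comment> \<open>Exact Taylor expansion of the quadratic \<open>G\<close> about its critical
    point; the normal equations cancel the linear terms.\<close>
  have gap: "G x y = G p q + (b * (x - p)\<^sup>2 - 2 * c * (x - p) * (y - q) + d * (y - q)\<^sup>2)"
  proof -
    have "a * (x - p) = (b * p - c * q) * (x - p)" "b * (y - q) = (c * p - d * q) * (y - q)"
      using normal_eqs by simp_all
    then show ?thesis
      unfolding G_eq by (simp add: power2_eq_square algebra_simps)
  qed
  note form = posdef_binary_quadratic_form[OF \<open>b > 0\<close> bd, of "x - p" "y - q"]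
  show "G p q \<le> G x y" "G x y = G p q \<longleftrightarrow> x = p \<and> y = q"
    using gap form by auto
qed

lemma diag_mult_vec: "(diag lam *v v) $ j = lam $ j * v $ j"
  by (simp add: diag_def matrix_vector_mult_def if_distrib[where f = "\<lambda>x. x * _"] cong: if_cong)

text \<open>The map \<open>transpose Q\<close> preserves norms and turns each factor
  \<open>mat 1 - r *\<^sub>R P\<close> into multiplication of coordinate \<open>j\<close> by
  \<open>1 - r * lam $ j\<close>. The product of the two factors is symmetric in \<open>s\<close>
  and \<open>t\<close>, and exchanging the sums over samples and coordinates collects the weights
  \<open>zbar\<close>.\<close>

lemma two_step_obj_eigenbasis:
  fixes P Q :: "real^'n^'n"
  assumes Q: "orthogonal_matrix Q" and P: "P = Q ** diag lam ** transpose Q"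
  shows "two_step_obj P \<theta> N x k (s, t) =
    (\<Sum>j\<in>UNIV. zbar Q P \<theta> N x k j * (1 - (s + t) * lam $ j + (s * t) * (lam $ j)\<^sup>2)\<^sup>2)"
proof -
  let ?Q = "transpose Q"
  have QQ: "?Q ** Q = mat 1" and oQ: "orthogonal_matrix ?Q"
    using Q by (auto simp: orthogonal_matrix_def)
  have step: "(?Q *v ((mat 1 - r *\<^sub>R P) *v v)) $ j = (1 - r * lam $ j) * (?Q *v v) $ j" for r v j
  proof -
    have "?Q *v (P *v v) = diag lam *v (?Q *v v)"
      unfolding P matrix_vector_mul_assoc matrix_mul_assoc QQ by simp
    moreover have "(r *\<^sub>R P) *v v = r *\<^sub>R (P *v v)"
      by (rule scaleR_matrix_vector_assoc[symmetric])
    ultimately have "?Q *v ((mat 1 - r *\<^sub>R P) *v v) = ?Q *v v - r *\<^sub>R (diag lam *v (?Q *v v))"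
      by (simp add: matrix_vector_mult_diff_rdistrib matrix_vector_mult_diff_distrib
          matrix_vector_mult_scaleR
          del: transpose_matrix_vector)
    then show ?thesis
      by (simp only: vector_minus_component vector_scaleR_component diag_mult_vec)
        (simp add: algebra_simps)
  qed
  have norm_eq: "(norm (((mat 1 - t *\<^sub>R P) ** (mat 1 - s *\<^sub>R P)) *v v))\<^sup>2 =
      (\<Sum>j\<in>UNIV. ((?Q *v v) $ j)\<^sup>2 * (1 - (s + t) * lam $ j + (s * t) * (lam $ j)\<^sup>2)\<^sup>2)" for v
  proof -
    define y where "y = ((mat 1 - t *\<^sub>R P) ** (mat 1 - s *\<^sub>R P)) *v v"
    have "norm y = norm (?Q *v y)"
      using oQ by (metis orthogonal_transformation_matrix orthogonal_transformation_norm
          matrix_vector_mul_linear matrix_of_matrix_vector_mul)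
    then have "(norm y)\<^sup>2 = (\<Sum>j\<in>UNIV. ((?Q *v y) $ j)\<^sup>2)"
      by (simp only: power2_norm_eq_inner) (simp add: inner_vec_def power2_eq_square)
    moreover have "(?Q *v y) $ j = (1 - (s + t) * lam $ j + (s * t) * (lam $ j)\<^sup>2) * (?Q *v v) $ j" for j
      unfolding y_def matrix_vector_mul_assoc[symmetric] step
      by (simp add: power2_eq_square algebra_simps)
    ultimately have "(norm y)\<^sup>2 =
        (\<Sum>j\<in>UNIV. ((1 - (s + t) * lam $ j + (s * t) * (lam $ j)\<^sup>2) * (?Q *v v) $ j)\<^sup>2)"
      by (simp only:)
    then show ?thesis
      by (simp only: y_def power_mult_distrib mult.commute)
  qed
  show ?thesis
    unfolding two_step_obj_def zbar_def prod.case norm_eq sum_distrib_right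
    by (rule sum.swap)
qed

theorem theorem4:
  fixes P Q :: "real^'n^'n"
    and lam :: "real^'n"
    and N k :: nat
    and x :: "nat \<Rightarrow> real^'n"
    and \<theta> :: "nat \<Rightarrow> real"
    and a b c d r\<^sub>p r\<^sub>m :: real
  assumes "symmetric_posdef P"
    and "orthogonal_matrix Q"
    and "\<And>j. lam $ j > 0"
    and "P = Q ** diag lam ** transpose Q"
    and "\<exists>j1 j2. zbar Q P \<theta> N x k j1 \<noteq> 0 \<and> zbar Q P \<theta> N x k j2 \<noteq> 0 \<and> lam $ j1 \<noteq> lam $ j2"
    and "a = (\<Sum>j\<in>UNIV. lam $ j * zbar Q P \<theta> N x k j)"
    and "b = (\<Sum>j\<in>UNIV. (lam $ j)^2 * zbar Q P \<theta> N x k j)"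
    and "c = (\<Sum>j\<in>UNIV. (lam $ j)^3 * zbar Q P \<theta> N x k j)"
    and "d = (\<Sum>j\<in>UNIV. (lam $ j)^4 * zbar Q P \<theta> N x k j)"
    and "r\<^sub>p = (a*d - b*c + sqrt ((b*c - a*d)^2 - 4 * (a*c - b^2) * (b*d - c^2))) / (2 * (b*d - c^2))"
    and "r\<^sub>m = (a*d - b*c - sqrt ((b*c - a*d)^2 - 4 * (a*c - b^2) * (b*d - c^2))) / (2 * (b*d - c^2))"
  shows "b*d - c^2 \<noteq> 0
    \<and> (b*c - a*d)^2 - 4 * (a*c - b^2) * (b*d - c^2) \<ge> 0
    \<and> {st. is_arg_min (two_step_obj P \<theta> N x k) (\<lambda>_. True) st} = {(r\<^sub>p, r\<^sub>m), (r\<^sub>m, r\<^sub>p)}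
    \<and> (\<forall>s t. is_arg_min (two_step_obj P \<theta> N x k) (\<lambda>_. True) (s, t) \<longrightarrow> s \<ge> 0 \<and> t \<ge> 0)"
proof -
  let ?w = "zbar Q P \<theta> N x k"
  define p q where "p = (a * d - b * c) / (b * d - c\<^sup>2)" and "q = (a * c - b\<^sup>2) / (b * d - c\<^sup>2)"
  define G where "G = (\<lambda>u v. \<Sum>j\<in>UNIV. ?w j * (1 - u * lam $ j + v * (lam $ j)\<^sup>2)\<^sup>2)"
  obtain i1 i2 where i: "?w i1 \<noteq> 0" "?w i2 \<noteq> 0" "lam $ i1 \<noteq> lam $ i2"
    using assms(5) by blast
  have "?w j \<ge> 0" for j
    by (simp add: zbar_def sum_nonneg)
  note minimizer = weighted_quadratic_minimizer[where \<mu> = "\<lambda>j. lam $ j",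
      OF finite[of UNIV] this assms(3) UNIV_I UNIV_I i assms(6-9) p_def q_def G_def]
  define D where "D = b * d - c\<^sup>2"
  have "D > 0"
    using minimizer(1) by (simp add: D_def)
  \<comment> \<open>Since \<open>a * d - b * c = D * p\<close> and
    \<open>a * c - b\<^sup>2 = D * q\<close>, the stated radicand is a rescaled discriminant of
    \<open>X\<^sup>2 - p * X + q\<close>.\<close>
  have disc: "(b*c - a*d)^2 - 4 * (a*c - b^2) * (b*d - c^2) = D\<^sup>2 * (p\<^sup>2 - 4 * q)"
    using \<open>D > 0\<close> unfolding p_def q_def D_def[symmetric]
    by (simp add: power_divide divide_simps) (simp add: power2_eq_square algebra_simps)
  have sqrt_disc: "sqrt ((b*c - a*d)^2 - 4 * (a*c - b^2) * (b*d - c^2)) = D * sqrt (p\<^sup>2 - 4 * q)"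
    unfolding disc using \<open>D > 0\<close> by (simp add: real_sqrt_mult)
  have "a * d - b * c = D * p"
    using \<open>D > 0\<close> by (simp add: p_def D_def)
  then have roots: "r\<^sub>p = (p + sqrt (p\<^sup>2 - 4 * q)) / 2" "r\<^sub>m = (p - sqrt (p\<^sup>2 - 4 * q)) / 2"
    using \<open>D > 0\<close> unfolding assms(10,11) sqrt_disc unfolding D_def[symmetric]
    by (simp_all add: field_simps)
  have "(sqrt (p\<^sup>2 - 4 * q))\<^sup>2 = p\<^sup>2 - 4 * q"
    using minimizer(4) by simp
  then have Vieta: "r\<^sub>p + r\<^sub>m = p" "r\<^sub>p * r\<^sub>m = q"
    unfolding roots by (simp_all add: field_simps power2_eq_square)
  have obj: "two_step_obj P \<theta> N x k (s, t) = G (s + t) (s * t)" for s t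
    unfolding G_def by (rule two_step_obj_eigenbasis[OF assms(2,4)])
  have argmin: "is_arg_min (two_step_obj P \<theta> N x k) (\<lambda>_. True) (s, t) \<longleftrightarrow>
      (s = r\<^sub>p \<and> t = r\<^sub>m) \<or> (s = r\<^sub>m \<and> t = r\<^sub>p)" for s t
  proof -
    have "is_arg_min (two_step_obj P \<theta> N x k) (\<lambda>_. True) (s, t) \<longleftrightarrow>
        (\<forall>s' t'. G (s + t) (s * t) \<le> G (s' + t') (s' * t'))"
      by (auto simp: is_arg_min_def obj not_less)
    \<comment> \<open>The lower bound \<open>G p q\<close> is attained by actual step sizes, namely
      \<open>r\<^sub>p\<close> and \<open>r\<^sub>m\<close>, so minimality means reaching this
      value.\<close>
    also have "\<dots> \<longleftrightarrow> G (s + t) (s * t) = G p q"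
      by (metis Vieta minimizer(5) order_antisym)
    also have "\<dots> \<longleftrightarrow> s + t = r\<^sub>p + r\<^sub>m \<and> s * t = r\<^sub>p * r\<^sub>m"
      by (simp add: minimizer(6) Vieta)
    finally show ?thesis
      unfolding sum_prod_eq_iff .
  qed
  \<comment> \<open>From \<open>q > 0\<close> and \<open>p > 0\<close>; this makes the smaller root
    \<open>r\<^sub>m\<close> non-negative.\<close>
  have "sqrt (p\<^sup>2 - 4 * q) \<le> p"
    using minimizer(2,3) by (intro real_le_lsqrt) auto
  moreover have "sqrt (p\<^sup>2 - 4 * q) \<ge> 0"
    using minimizer(4) by simp
  ultimately have "r\<^sub>p \<ge> 0" "r\<^sub>m \<ge> 0"
    using minimizer(3) by (simp_all add: roots)
  then have "\<forall>s t. is_arg_min (two_step_obj P \<theta> N x k) (\<lambda>_. True) (s, t) \<longrightarrow> s \<ge> 0 \<and> t \<ge> 0"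
    by (auto simp: argmin)
  moreover have "{st. is_arg_min (two_step_obj P \<theta> N x k) (\<lambda>_. True) st} = {(r\<^sub>p, r\<^sub>m), (r\<^sub>m, r\<^sub>p)}"
    by (auto simp: argmin)
  moreover have "(b*c - a*d)^2 - 4 * (a*c - b^2) * (b*d - c^2) \<ge> 0"
    unfolding disc using minimizer(4) by simp
  ultimately show ?thesis
    using minimizer(1) by simp
qed

end
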